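(* Assume that there exists a weight $2$ modular form $\chi\in M_2$ which is invertible in $R$, let $u=x\chi$, and for $k\ge0$ let $g_{k,2n}\in M_{2n}$ be defined by $\Psi_2^{-1}(u^k)=\sum_{n\ge k}g_{k,2n}$. Then $g_{k,2k+2i}=0$ for any nonnegative integer $k$ and any nonnegative odd integer $i$.
   Context: $\Gamma$ is a subgroup of $\mathrm{SL}(2,\mathbb{C})$ and $R$ is a commutative $\mathbb{C}$-algebra of functions in one variable $z$, which is a domain, such that: (i) $\Gamma$ acts on the right on $R$ by automorphisms $(f\cdot\gamma)(z)=f\left(\frac{az+b}{cz+d}\right)$ for $\gamma=\begin{pmatrix}a&b\\c&d\end{pmatrix}$; (ii) the function $z\mapsto cz+d$ is an invertible element of $R$ for every $\gamma\in\Gamma$; (iii) $R$ is stable under $\partial_z=\frac{d}{dz}$, which is nonzero on $R$. Put $d_z=-\partial_z$, $f^{(n)}=\partial_z^nf$. For $k\in\mathbb{Z}$, $M_k=\{f\in R: f\left(\frac{az+b}{cz+d}\right)=(cz+d)^kf(z)\ \forall\gamma\in\Gamma\}$. It is assumed that $M_k\cap M_\ell=\{0\}$ for $k\ne\ell$; elements of $\prod_jM_{2j}$ are written as formal sums of their components. $B=R(\!(x;d_z)\!)$ is the ring of Laurent series $\sum_{i\ge m}f_ix^i$ with coefficients in $R$ and $xf=\sum_{n\ge0}d_z^n(f)x^{n+1}$; $B_0$ is its subring of power series in $x$. $\Gamma$ acts on $B$ by automorphisms extending the action on $R$ with $(x^{-1}|\gamma)=(cz+d)^2x^{-1}$; $B_0^\Gamma$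 is the subring of invariant elements of $B_0$; $u=x\chi\in B_0^\Gamma$. $\Psi_2:\prod_{j\ge0}M_{2j}\to B_0^\Gamma$ is the vector space isomorphism $\sum_jf_{2j}\mapsto\sum_j\psi_{2j}(f_{2j})$, where $\psi_0(f)=f$ and, for $j\ge1$, $$\psi_{2j}(f)=\sum_{n\ge0}\frac{(2j-1)!\,(n+j-1)!}{(n+2j-1)!\,(j-1)!}\binom{-j-1}{n}f^{(n)}x^{j+n}.$$ *)

theory Defs
  imports "HOL-Analysis.Analysis"
begin

section \<open>Function algebras with a homographic action\<close>

definition homography :: "complex^2^2 \<Rightarrow> complex \<Rightarrow> complex"
  where "homography \<gamma> z = (\<gamma>$1$1 * z + \<gamma>$1$2) / (\<gamma>$2$1 * z + \<gamma>$2$2)"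

definition automorphy :: "complex^2^2 \<Rightarrow> complex \<Rightarrow> complex"
  where "automorphy \<gamma> z = \<gamma>$2$1 * z + \<gamma>$2$2"

text \<open>
  Functions may have poles, as in the algebra of rational functions or of meromorphic functions
  on the upper half-plane, so two functions on \<open>U\<close> are identified when they agree outside a
  countable set; for functions that are continuous on the open set \<open>U\<close> this is plain equality on
  \<open>U\<close>. Countable sets, unlike sparse ones, are always stable under preimages of homographies.
\<close>

definition same_function :: "complex set \<Rightarrow> (complex \<Rightarrow> complex) \<Rightarrow> (complex \<Rightarrow> complex) \<Rightarrow> bool"
  where "same_function U f g \<longleftrightarrow> countable {z \<in> U. f z \<noteq> g z}"

text \<open>
  An algebra of functions on \<open>U\<close> is a type \<open>'r\<close> together with the map \<open>ev\<close> sending an element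
  to the function it is. The pointwise conditions in the locale below determine all operations.
\<close>

definition modular_forms ::
    "complex set \<Rightarrow> (complex^2^2) set \<Rightarrow> ('r \<Rightarrow> complex \<Rightarrow> complex) \<Rightarrow> int \<Rightarrow> 'r set"
  where "modular_forms U \<Gamma> ev k =
    {f. \<forall>\<gamma>\<in>\<Gamma>. same_function U (\<lambda>z. ev f (homography \<gamma> z)) (\<lambda>z. automorphy \<gamma> z powi k * ev f z)}"

locale homographic_function_algebra =
  fixes U :: "complex set"
    and \<Gamma> :: "(complex^2^2) set"
    and ev :: "'r::idom \<Rightarrow> complex \<Rightarrow> complex"
    and smul :: "complex \<Rightarrow> 'r \<Rightarrow> 'r"
    and D :: "'r \<Rightarrow> 'r"
  assumes open_domain: "open U"
    and group_SL2: "\<gamma> \<in> \<Gamma> \<Longrightarrow> det \<gamma> = 1"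
    and group_one: "mat 1 \<in> \<Gamma>"
    and group_mult: "\<gamma> \<in> \<Gamma> \<Longrightarrow> \<delta> \<in> \<Gamma> \<Longrightarrow> \<gamma> ** \<delta> \<in> \<Gamma>"
    and group_inv: "\<gamma> \<in> \<Gamma> \<Longrightarrow> matrix_inv \<gamma> \<in> \<Gamma>"
    and domain_stable: "\<gamma> \<in> \<Gamma> \<Longrightarrow> z \<in> U \<Longrightarrow> automorphy \<gamma> z \<noteq> 0 \<Longrightarrow> homography \<gamma> z \<in> U"
    \<comment> \<open>\<open>'r\<close> is a complex algebra of functions on \<open>U\<close>\<close>
    and ev_analytic: "countable {z \<in> U. \<not> ev f analytic_on {z}}"
    and ev_inject: "same_function U (ev f) (ev g) \<Longrightarrow> f = g"
    and ev_one: "same_function U (ev 1) (\<lambda>z. 1)"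
    and ev_add: "same_function U (ev (f + g)) (\<lambda>z. ev f z + ev g z)"
    and ev_mult: "same_function U (ev (f * g)) (\<lambda>z. ev f z * ev g z)"
    and ev_smul: "same_function U (ev (smul c f)) (\<lambda>z. c * ev f z)"
    \<comment> \<open>stability under the action, which is then automatically a right action by automorphisms\<close>
    and action_stable: "\<gamma> \<in> \<Gamma> \<Longrightarrow> \<exists>g. same_function U (ev g) (\<lambda>z. ev f (homography \<gamma> z))"
    and automorphy_unit: "\<gamma> \<in> \<Gamma> \<Longrightarrow> \<exists>j. j dvd 1 \<and> same_function U (ev j) (automorphy \<gamma>)"
    and ev_deriv: "same_function U (ev (D f)) (deriv (ev f))"
    and deriv_nonzero: "\<exists>f. D f \<noteq> 0"
    and forms_disjoint: "k \<noteq> l \<Longrightarrow> modular_forms U \<Gamma> ev k \<inter> modular_forms U \<Gamma> ev l = {0}"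


section \<open>Skew power series\<close>

text \<open>
  A sequence \<open>a :: nat \<Rightarrow> 'r\<close> stands for the power series \<open>\<Sum>i. a i x^i\<close> with coefficients
  written on the left. Left multiplication by \<open>x\<close> follows from
  \<open>x f = \<Sum>n. d^n(f) x^(n+1)\<close> with \<open>d = -D\<close>.
\<close>

definition x_times :: "('r::idom \<Rightarrow> 'r) \<Rightarrow> (nat \<Rightarrow> 'r) \<Rightarrow> nat \<Rightarrow> 'r"
  where "x_times D b m = (\<Sum>n<m. ((\<lambda>f. - D f) ^^ n) (b (m - 1 - n)))"

text \<open>
  The product is \<open>\<Sum>i. a i (x^i b)\<close>; since \<open>x^i b\<close> has order at least \<open>i\<close>, only the terms with
  \<open>i \<le> m\<close> contribute to the coefficient of \<open>x^m\<close>.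
\<close>

definition skew_mult :: "('r::idom \<Rightarrow> 'r) \<Rightarrow> (nat \<Rightarrow> 'r) \<Rightarrow> (nat \<Rightarrow> 'r) \<Rightarrow> nat \<Rightarrow> 'r"
  where "skew_mult D a b m = (\<Sum>i\<le>m. a i * ((x_times D ^^ i) b) m)"

definition skew_const :: "'r::idom \<Rightarrow> nat \<Rightarrow> 'r"
  where "skew_const f m = (if m = 0 then f else 0)"

definition skew_x :: "nat \<Rightarrow> 'r::idom"
  where "skew_x m = (if m = 1 then 1 else 0)"

primrec skew_power :: "('r::idom \<Rightarrow> 'r) \<Rightarrow> (nat \<Rightarrow> 'r) \<Rightarrow> nat \<Rightarrow> nat \<Rightarrow> 'r"
  where
    "skew_power D a 0 = skew_const 1"
  | "skew_power D a (Suc k) = skew_mult D a (skew_power D a k)"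


section \<open>Lifting modular forms\<close>

text \<open>
  \<open>psi smul D j f\<close> is the lift of a form \<open>f\<close> of weight \<open>2j\<close>; its coefficient at \<open>x^m\<close> is
  that of the defining series at \<open>n = m - j\<close>.
\<close>

definition psi :: "(complex \<Rightarrow> 'r \<Rightarrow> 'r) \<Rightarrow> ('r::idom \<Rightarrow> 'r) \<Rightarrow> nat \<Rightarrow> 'r \<Rightarrow> nat \<Rightarrow> 'r"
  where "psi smul D j f =
    (if j = 0 then skew_const f
     else (\<lambda>m. if m < j then 0 else
       (let n = m - j in
         smul (fact (2 * j - 1) * fact (n + j - 1) / (fact (n + 2 * j - 1) * fact (j - 1))
                * ((- of_nat j - 1) gchoose n))
           ((D ^^ n) f))))"

text \<open>
  A sequence \<open>F\<close> stands for the formal sum of its components \<open>F j\<close> of weight \<open>2j\<close>.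
  As \<open>psi smul D j f\<close> has order at least \<open>j\<close>, each coefficient of the infinite sum of lifts is
  a finite sum.
\<close>

definition Psi2 :: "(complex \<Rightarrow> 'r \<Rightarrow> 'r) \<Rightarrow> ('r::idom \<Rightarrow> 'r) \<Rightarrow> (nat \<Rightarrow> 'r) \<Rightarrow> nat \<Rightarrow> 'r"
  where "Psi2 smul D F m = (\<Sum>j\<le>m. psi smul D j (F j) m)"

end

theory Submission
  imports Defs
begin

text \<open>
  Read \<open>x\<close> as \<open>\<partial>\<^sup>-\<^sup>1\<close>. Then \<open>u = x \<chi>\<close> is the inverse of the derivation
  \<open>\<chi>\<^sup>-\<^sup>1 \<partial>\<close>. Let \<open>P \<mapsto> P*\<close> be the formal adjoint, the anti-automorphism
  that fixes functions and negates \<open>x\<close>, and put \<open>\<tau> P = x P* x\<^sup>-\<^sup>1\<close>. Since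
  \<open>u* = - \<chi> x\<close>, we get \<open>\<tau> u = - u\<close>, and \<open>\<tau>\<close> reverses products, so
  \<open>\<tau> (u^k) = (-1)^k u^k\<close>. Conjugation by \<open>x\<close> is there because the adjoint turns the lift of a
  form to operators acting on functions into a lift to operators acting on forms of weight two,
  and \<open>\<partial>\<close> intertwines the two actions. Accordingly \<open>\<tau>\<close> sends the lift
  of a form of weight \<open>2j\<close> to \<open>(-1)^j\<close> times itself if \<open>j > 0\<close>, and it fixes
  constants (lemma \<open>reflection_psi\<close>). Comparing both sides of \<open>Psi2 F = u^k\<close> and using that
  \<open>Psi2\<close> is injective gives \<open>(-1)^j F j = (-1)^k F j\<close>, which kills the components with
  \<open>j - k\<close> odd.

  All this becomes commutative once a series \<open>\<Sum>m. a m x^m\<close> is identified with the function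
  \<open>A(z,t) = \<Sum>m. a m (z) t^m / m!\<close>. Right multiplication by \<open>x\<close> is then
  integration in \<open>t\<close>, left multiplication by \<open>x\<close> is the inverse of
  \<open>\<delta> = \<partial>\<^sub>t + \<partial>\<^sub>z\<close>, and \<open>\<tau>\<close> is the substitution
  \<open>A(z,t) \<mapsto> A(z - t, - t)\<close>. The first two turn the recursion for \<open>u^k\<close> into the
  differential equation \<open>\<delta> (u^(k+1)) = \<chi> u^k\<close>, solved by
  \<open>u^k = (W(z) - W(z - t))^k / k!\<close> with \<open>W\<close> a primitive of \<open>\<chi>\<close>
  (lemma \<open>fact_skew_power\<close>): the parity of \<open>u^k\<close> under the substitution is visible. Up to a
  constant, the lift of \<open>f\<close> is \<open>t^j\<close> times the average of \<open>f(z - s t)\<close> over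
  \<open>0 \<le> s \<le> 1\<close> with weight \<open>s^(j-1) (1-s)^(j-1)\<close>, and its parity is the
  symmetry of this weight under \<open>s \<mapsto> 1 - s\<close> (lemma \<open>beta_sum\<close>).
\<close>

section \<open>Functions up to countable sets\<close>

text \<open>
  A filter, so that finitely many identities between functions combine by \<open>eventually_elim\<close>.
\<close>

definition cocountable :: "complex set \<Rightarrow> complex filter"
  where "cocountable U = Abs_filter (\<lambda>P. countable {z \<in> U. \<not> P z})"

lemma eventually_cocountable: "eventually P (cocountable U) \<longleftrightarrow> countable {z \<in> U. \<not> P z}"
proof -
  have "is_filter (\<lambda>P. countable {z \<in> U. \<not> P z})"
  proof (rule is_filter.intro)
    fix P Q assume "countable {z \<in> U. \<not> P z}" "countable {z \<in> U. \<not> Q z}"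
    then have "countable ({z \<in> U. \<not> P z} \<union> {z \<in> U. \<not> Q z})"
      by (rule countable_Un)
    then show "countable {z \<in> U. \<not> (P z \<and> Q z)}"
      by (rule countable_subset[rotated]) auto
  next
    fix P Q assume "\<forall>z. P z \<longrightarrow> Q z" "countable {z \<in> U. \<not> P z}"
    then show "countable {z \<in> U. \<not> Q z}"
      by (elim countable_subset[rotated]) auto
  qed simp
  then show ?thesis
    by (simp add: cocountable_def eventually_Abs_filter)
qed

lemma same_function_eventually: "same_function U f g \<longleftrightarrow> (\<forall>\<^sub>F z in cocountable U. f z = g z)"
  by (simp add: same_function_def eventually_cocountable)

text \<open>
  The points near \<open>z\<close> where the two functions differ form an open countable set, and nonempty
  open sets are uncountable. Identities up to countable sets can therefore be differentiated.
\<close>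

lemma analytic_eq_near:
  assumes "open U" "z \<in> U" "f analytic_on {z}" "g analytic_on {z}" "same_function U f g"
  shows "\<forall>\<^sub>F w in nhds z. f w = g w"
proof -
  obtain V where V: "open V" "z \<in> V" "V \<subseteq> U" "f holomorphic_on V" "g holomorphic_on V"
  proof -
    obtain A B where "open A" "z \<in> A" "f holomorphic_on A" "open B" "z \<in> B" "g holomorphic_on B"
      using assms(3,4) by (auto simp: analytic_at)
    then show ?thesis
      using assms(1,2) by (intro that[of "A \<inter> B \<inter> U"]) (auto intro: holomorphic_on_subset)
  qed
  define W where "W = {w \<in> V. f w - g w \<in> - {0}}"
  have "continuous_on V (\<lambda>w. f w - g w)"
    using V by (intro continuous_on_diff holomorphic_on_imp_continuous_on)
  then have "open W"
    using V(1) continuous_open_preimage[of V "\<lambda>w. f w - g w" "- {0}"]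
    by (simp add: W_def vimage_def Int_def open_Compl conj_commute)
  moreover have "countable W"
    using assms(5) unfolding same_function_def
    by (rule countable_subset[rotated]) (use V(3) in \<open>auto simp: W_def\<close>)
  ultimately have "W = {}"
    by (metis all_not_in_conv countable_subset open_contains_ball uncountable_ball)
  then have "\<forall>w\<in>V. f w = g w"
    by (auto simp: W_def)
  then show ?thesis
    using V(1,2) by (auto simp: eventually_nhds)
qed

section \<open>The function algebra as a differential algebra\<close>

locale complex_differential_algebra =
  fixes smul :: "complex \<Rightarrow> 'r::idom \<Rightarrow> 'r"
    and D :: "'r \<Rightarrow> 'r"
  assumes D_add: "D (f + g) = D f + D g"
    and D_mult: "D (f * g) = D f * g + f * D g"
    and D_smul: "D (smul c f) = smul c (D f)"
    and smul_one: "smul 1 f = f"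
    and smul_add_left: "smul (a + b) f = smul a f + smul b f"
    and smul_add_right: "smul c (f + g) = smul c f + smul c g"
    and smul_smul: "smul a (smul b f) = smul (a * b) f"

context homographic_function_algebra
begin

lemma ev_eventually:
  "\<forall>\<^sub>F z in cocountable U. ev (f + g) z = ev f z + ev g z"
  "\<forall>\<^sub>F z in cocountable U. ev (f * g) z = ev f z * ev g z"
  "\<forall>\<^sub>F z in cocountable U. ev (smul c f) z = c * ev f z"
  using ev_add ev_mult ev_smul by (simp_all add: same_function_eventually)

lemma eqI: "\<forall>\<^sub>F z in cocountable U. ev f z = ev g z \<Longrightarrow> f = g"
  using ev_inject by (simp add: same_function_eventually)

lemma eventually_analytic: "\<forall>\<^sub>F z in cocountable U. ev f analytic_on {z}"
  using ev_analytic by (simp add: eventually_cocountable)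

lemma eventually_in_domain: "\<forall>\<^sub>F z in cocountable U. z \<in> U"
  by (simp add: eventually_cocountable)

lemma ev_D_eqI:
  assumes "same_function U (ev f) h"
    and h: "\<forall>\<^sub>F z in cocountable U. h analytic_on {z} \<and> deriv h z = d z"
  shows "\<forall>\<^sub>F z in cocountable U. ev (D f) z = d z"
  using ev_deriv[of f, unfolded same_function_eventually] h eventually_analytic[of f]
    eventually_in_domain
proof eventually_elim
  case (elim z)
  then have "\<forall>\<^sub>F w in nhds z. ev f w = h w"
    using analytic_eq_near open_domain assms(1) by blast
  then have "deriv (ev f) z = deriv h z"
    by (rule deriv_cong_ev) simp
  with elim show ?case by simp
qed

text \<open>
  Each rule holds pointwise outside a countable set, by complex analysis, and an element is
  determined by its values there.
\<close>

lemma complex_differential_algebra: "complex_differential_algebra smul D"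
proof
  note D_ev = ev_deriv[unfolded same_function_eventually]
  have diff: "ev f analytic_on {z} \<Longrightarrow> ev f field_differentiable at z" for f z
    by (rule analytic_on_imp_differentiable_at) auto
  fix f g :: 'r and a b c :: complex
  have "\<forall>\<^sub>F z in cocountable U. ev (D (f + g)) z = deriv (ev f) z + deriv (ev g) z"
    using eventually_analytic[of f] eventually_analytic[of g]
    by (intro ev_D_eqI[OF ev_add], eventually_elim) (simp add: analytic_on_add diff)
  then have "\<forall>\<^sub>F z in cocountable U. ev (D (f + g)) z = ev (D f + D g) z"
    using D_ev[of f] D_ev[of g] ev_eventually(1)[of "D f" "D g"] by eventually_elim simp
  then show "D (f + g) = D f + D g"
    by (rule eqI)
  have "\<forall>\<^sub>F z in cocountable U.
      ev (D (f * g)) z = ev f z * deriv (ev g) z + deriv (ev f) z * ev g z"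
    using eventually_analytic[of f] eventually_analytic[of g]
    by (intro ev_D_eqI[OF ev_mult], eventually_elim) (simp add: analytic_on_mult diff)
  then have "\<forall>\<^sub>F z in cocountable U. ev (D (f * g)) z = ev (D f * g + f * D g) z"
    using D_ev[of f] D_ev[of g] ev_eventually(1)[of "D f * g" "f * D g"]
      ev_eventually(2)[of "D f" g] ev_eventually(2)[of f "D g"] by eventually_elim simp
  then show "D (f * g) = D f * g + f * D g"
    by (rule eqI)
  have "\<forall>\<^sub>F z in cocountable U. ev (D (smul c f)) z = c * deriv (ev f) z"
    using eventually_analytic[of f]
    by (intro ev_D_eqI[OF ev_smul], eventually_elim)
      (simp add: analytic_on_mult analytic_on_const diff)
  then have "\<forall>\<^sub>F z in cocountable U. ev (D (smul c f)) z = ev (smul c (D f)) z"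
    using D_ev[of f] ev_eventually(3)[of c "D f"] by eventually_elim simp
  then show "D (smul c f) = smul c (D f)"
    by (rule eqI)
  show "smul 1 f = f"
    by (intro eqI, use ev_eventually(3)[of 1 f] in eventually_elim) simp
  show "smul (a + b) f = smul a f + smul b f"
    by (intro eqI, use ev_eventually(3)[of "a + b" f] ev_eventually(3)[of a f] ev_eventually(3)[of b f]
        ev_eventually(1)[of "smul a f" "smul b f"] in eventually_elim) (simp add: algebra_simps)
  show "smul c (f + g) = smul c f + smul c g"
    by (intro eqI, use ev_eventually(3)[of c "f + g"] ev_eventually(3)[of c f] ev_eventually(3)[of c g]
        ev_eventually(1)[of f g] ev_eventually(1)[of "smul c f" "smul c g"] in eventually_elim)
      (simp add: algebra_simps)
  show "smul a (smul b f) = smul (a * b) f"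
    by (intro eqI, use ev_eventually(3)[of a "smul b f"] ev_eventually(3)[of b f]
        ev_eventually(3)[of "a * b" f] in eventually_elim) (simp add: algebra_simps)
qed

end

section \<open>Hurwitz products\<close>

text \<open>
  The product of the exponential generating functions \<open>\<Sum>m. a m t^m / m!\<close>, written on the
  coefficients so that no division occurs.
\<close>

definition hurwitz_mult :: "(nat \<Rightarrow> 'r) \<Rightarrow> (nat \<Rightarrow> 'r) \<Rightarrow> nat \<Rightarrow> 'r::comm_ring_1"
  where "hurwitz_mult a b m = (\<Sum>i\<le>m. of_nat (m choose i) * (a i * b (m - i)))"

lemma hurwitz_mult_0 [simp]: "hurwitz_mult a b 0 = a 0 * b 0"
  by (simp add: hurwitz_mult_def)

lemma hurwitz_mult_add:
  "hurwitz_mult (\<lambda>m. a m + a' m) b m = hurwitz_mult a b m + hurwitz_mult a' b m"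
  "hurwitz_mult a (\<lambda>m. b m + b' m) m = hurwitz_mult a b m + hurwitz_mult a b' m"
  by (simp_all add: hurwitz_mult_def algebra_simps sum.distrib)

lemma hurwitz_mult_scale:
  "hurwitz_mult (\<lambda>m. r * a m) b m = r * hurwitz_mult a b m"
  "hurwitz_mult a (\<lambda>m. r * b m) m = r * hurwitz_mult a b m"
  by (simp_all add: hurwitz_mult_def algebra_simps sum_distrib_left)

lemma hurwitz_mult_minus:
  "hurwitz_mult (\<lambda>m. - a m) b m = - hurwitz_mult a b m"
  "hurwitz_mult a (\<lambda>m. - b m) m = - hurwitz_mult a b m"
  by (simp_all add: hurwitz_mult_def sum_negf)

lemma hurwitz_mult_const: "hurwitz_mult (skew_const f) b m = f * b m"
proof -
  have "hurwitz_mult (skew_const f) b m = (\<Sum>i\<in>{0}. of_nat (m choose i) * (skew_const f i * b (m - i)))"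
    unfolding hurwitz_mult_def by (rule sum.mono_neutral_right) (auto simp: skew_const_def)
  then show ?thesis by (simp add: skew_const_def)
qed

text \<open>
  The shift of sequences is the derivative in \<open>t\<close> of exponential generating functions, so this is
  the Leibniz rule.
\<close>

lemma hurwitz_mult_Suc:
  "hurwitz_mult a b (Suc m) =
    hurwitz_mult (\<lambda>i. a (Suc i)) b m + hurwitz_mult a (\<lambda>i. b (Suc i)) m"
proof -
  have "hurwitz_mult a (\<lambda>i. b (Suc i)) m = (\<Sum>i\<le>Suc m. of_nat (m choose i) * (a i * b (Suc m - i)))"
    unfolding hurwitz_mult_def by (simp add: Suc_diff_le binomial_eq_0)
  also have "\<dots> = a 0 * b (Suc m) + (\<Sum>i\<le>m. of_nat (m choose Suc i) * (a (Suc i) * b (m - i)))"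
    by (subst sum.atMost_Suc_shift) simp
  finally have "hurwitz_mult a (\<lambda>i. b (Suc i)) m = \<dots>" .
  moreover have "hurwitz_mult a b (Suc m) =
      a 0 * b (Suc m) + (\<Sum>i\<le>m. of_nat (Suc m choose Suc i) * (a (Suc i) * b (m - i)))"
    unfolding hurwitz_mult_def by (subst sum.atMost_Suc_shift) simp
  ultimately show ?thesis
    by (simp add: hurwitz_mult_def algebra_simps sum.distrib)
qed

primrec hurwitz_power :: "(nat \<Rightarrow> 'r::idom) \<Rightarrow> nat \<Rightarrow> nat \<Rightarrow> 'r"
  where
    "hurwitz_power a 0 = skew_const 1"
  | "hurwitz_power a (Suc k) = hurwitz_mult a (hurwitz_power a k)"

section \<open>The reflection and the powers of a series of order one\<close>

text \<open>
  From \<open>x\<^sup>-\<^sup>1 f = f x\<^sup>-\<^sup>1 + D f\<close>, this is the part of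
  \<open>x\<^sup>-\<^sup>1 a\<close> in nonnegative powers of \<open>x\<close>, hence all of it when \<open>a\<close> has no
  constant term. On generating functions it is \<open>\<partial>\<^sub>t + \<partial>\<^sub>z\<close>.
\<close>

definition x_inv_times :: "('r::idom \<Rightarrow> 'r) \<Rightarrow> (nat \<Rightarrow> 'r) \<Rightarrow> nat \<Rightarrow> 'r"
  where "x_inv_times D a m = a (Suc m) + D (a m)"

text \<open>
  The substitution \<open>A(z,t) \<mapsto> A(z - t, - t)\<close>: along \<open>t \<mapsto> (z - t, - t)\<close> the
  derivative in \<open>t\<close> is \<open>- (\<partial>\<^sub>t + \<partial>\<^sub>z)\<close>, so the \<open>m\<close>-th
  derivative at \<open>t = 0\<close> is \<open>(-1)^m\<close> times that of \<open>x_inv_times ^^ m\<close>. On operators it is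
  \<open>P \<mapsto> x P* x\<^sup>-\<^sup>1\<close> with \<open>P*\<close> the formal adjoint.
\<close>

definition reflection :: "('r::idom \<Rightarrow> 'r) \<Rightarrow> (nat \<Rightarrow> 'r) \<Rightarrow> nat \<Rightarrow> 'r"
  where "reflection D a m = (- 1) ^ m * (x_inv_times D ^^ m) a 0"

context complex_differential_algebra
begin

lemma D_0 [simp]: "D 0 = 0"
  using D_add[of 0 0] by (metis add_0_right add_left_cancel)

lemma D_1 [simp]: "D 1 = 0"
  using D_mult[of 1 1] by (metis add_0_right add_left_cancel mult_1_left mult_1_right)

lemma D_minus [simp]: "D (- f) = - D f"
  using D_add[of f "- f"] by (simp add: minus_unique)

lemma D_of_nat [simp]: "D (of_nat n) = 0"
  by (induction n) (simp_all add: D_add)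

lemma D_of_nat_mult: "D (of_nat n * f) = of_nat n * D f"
  by (simp add: D_mult)

lemma D_minus_one_power_mult: "D ((- 1) ^ n * f) = (- 1) ^ n * D f"
  by (cases "even n") simp_all

lemma D_sum: "D (\<Sum>i\<in>A. h i) = (\<Sum>i\<in>A. D (h i))"
  by (induction A rule: infinite_finite_induct) (simp_all add: D_add)

lemma D_funpow_smul: "(D ^^ n) (smul c f) = smul c ((D ^^ n) f)"
  by (induction n) (simp_all add: D_smul)

lemma D_funpow_0 [simp]: "(D ^^ n) 0 = 0"
  by (induction n) simp_all

lemma smul_0_left [simp]: "smul 0 f = 0"
  using smul_add_left[of 0 0 f] by (metis add_0_right add_left_cancel)

lemma smul_0_right [simp]: "smul c 0 = 0"
  using smul_add_right[of c 0 0] by (metis add_0_right add_left_cancel)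

lemma smul_minus_right: "smul c (- f) = - smul c f"
  using smul_add_right[of c f "- f"] by (simp add: minus_unique)

lemma smul_minus_one_power: "smul ((- 1) ^ n * c) f = (- 1) ^ n * smul c f"
proof -
  have "smul (- c) f = - smul c f"
    using smul_add_left[of c "- c" f] by (simp add: minus_unique)
  then show ?thesis by (cases "even n") simp_all
qed

lemma smul_of_nat_mult: "smul (of_nat n * c) f = of_nat n * smul c f"
  by (induction n) (simp_all add: algebra_simps smul_add_left)

lemma smul_sum_left: "smul (\<Sum>i\<in>A. h i) f = (\<Sum>i\<in>A. smul (h i) f)"
  by (induction A rule: infinite_finite_induct) (simp_all add: smul_add_left)

text \<open>
  Scalar multiplication by \<open>1 / n\<close> makes the algebra torsion-free.
\<close>

lemma of_nat_mult_cancel: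
  assumes "n \<noteq> 0" and "of_nat n * f = of_nat n * (g :: 'r)"
  shows "f = g"
proof -
  have inv: "smul (1 / of_nat n) (of_nat n * h) = h" for h
    using assms(1) smul_smul[of "1 / of_nat n" "of_nat n" h] smul_of_nat_mult[of n 1 h]
    by (simp add: smul_one)
  show ?thesis by (metis inv assms(2))
qed

abbreviation "\<delta> \<equiv> x_inv_times D"
abbreviation "\<tau> \<equiv> reflection D"

text \<open>
  A solution of \<open>(\<partial>\<^sub>t + \<partial>\<^sub>z) a = b\<close> is determined by its value at
  \<open>t = 0\<close>.
\<close>

lemma x_inv_times_eqD:
  assumes "\<delta> a = \<delta> b" and "a 0 = b 0"
  shows "a = b"
proof
  fix m show "a m = b m"
  proof (induction m)
    case (Suc m)
    then show ?case using fun_cong[OF assms(1), of m] by (simp add: x_inv_times_def)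
  qed (rule assms(2))
qed

lemma x_times_0 [simp]: "x_times D b 0 = 0"
  by (simp add: x_times_def)

lemma x_times_Suc: "x_times D b (Suc m) = b m - D (x_times D b m)"
proof -
  have "x_times D b (Suc m) =
      b m + (\<Sum>n<m. ((\<lambda>f. - D f) ^^ Suc n) (b (m - Suc n)))"
    unfolding x_times_def by (subst sum.lessThan_Suc_shift) simp
  also have "(\<Sum>n<m. ((\<lambda>f. - D f) ^^ Suc n) (b (m - Suc n))) = - D (x_times D b m)"
    unfolding x_times_def by (simp add: D_sum sum_negf)
  finally show ?thesis by simp
qed

lemma x_inv_times_x_times: "\<delta> (x_times D b) = b"
  by (simp add: x_inv_times_def x_times_Suc fun_eq_iff)

lemma x_times_funpow_low: "m < i \<Longrightarrow> (x_times D ^^ i) b m = 0"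
proof (induction i arbitrary: m)
  case (Suc i)
  from Suc.prems show ?case
    by (induction m) (simp_all add: x_times_Suc Suc.IH)
qed simp

lemma skew_mult_skew_x: "skew_mult D skew_x b = x_times D b"
proof
  fix m
  have "skew_mult D skew_x b m = (\<Sum>i\<in>{..m} \<inter> {1}. (x_times D ^^ i) b m)"
    unfolding skew_mult_def by (rule sum.mono_neutral_cong_right) (auto simp: skew_x_def)
  then show "skew_mult D skew_x b m = x_times D b m"
    by (cases m) auto
qed

lemma skew_mult_const: "skew_mult D (skew_const f) b m = f * b m"
proof -
  have "skew_mult D (skew_const f) b m = (\<Sum>i\<in>{0}. f * (x_times D ^^ i) b m)"
    unfolding skew_mult_def by (rule sum.mono_neutral_cong_right) (auto simp: skew_const_def)
  then show ?thesis by simp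
qed

text \<open>
  This is \<open>x\<^sup>-\<^sup>1 (a b) = (x\<^sup>-\<^sup>1 a) b\<close>, the only instance of associativity
  that is needed.
\<close>

lemma x_inv_times_skew_mult:
  assumes "a 0 = 0"
  shows "\<delta> (skew_mult D a b) = skew_mult D (\<delta> a) b"
proof
  fix m
  define y where "y i = (x_times D ^^ i) b" for i
  have y: "y (Suc i) (Suc n) = y i n - D (y (Suc i) n)" for i n
    by (simp add: y_def x_times_Suc)
  \<comment> \<open>The added term vanishes because \<open>x^(m+1) b\<close> has order at least \<open>m + 1\<close>.\<close>
  have "(\<Sum>i\<le>m. a i * D (y i m)) = (\<Sum>i\<le>Suc m. a i * D (y i m))"
    using x_times_funpow_low[of m "Suc m" b] by (simp add: y_def)
  also have "\<dots> = (\<Sum>i\<le>m. a (Suc i) * D (y (Suc i) m))"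
    by (subst sum.atMost_Suc_shift) (simp add: assms)
  finally have shift: "(\<Sum>i\<le>m. a i * D (y i m)) = \<dots>" .
  have "\<delta> (skew_mult D a b) m = (\<Sum>i\<le>Suc m. a i * y i (Suc m)) + D (\<Sum>i\<le>m. a i * y i m)"
    by (simp add: x_inv_times_def skew_mult_def y_def)
  also have "(\<Sum>i\<le>Suc m. a i * y i (Suc m)) = (\<Sum>i\<le>m. a (Suc i) * y (Suc i) (Suc m))"
    by (subst sum.atMost_Suc_shift) (simp add: assms)
  also have "\<dots> + D (\<Sum>i\<le>m. a i * y i m) = (\<Sum>i\<le>m. (a (Suc i) + D (a i)) * y i m)"
    by (simp add: y D_sum D_mult algebra_simps sum.distrib sum_subtractf shift)
  finally show "\<delta> (skew_mult D a b) m = skew_mult D (\<delta> a) b m"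
    by (simp add: x_inv_times_def skew_mult_def y_def)
qed

lemma x_inv_times_hurwitz_mult:
  "\<delta> (hurwitz_mult a b) m = hurwitz_mult (\<delta> a) b m + hurwitz_mult a (\<delta> b) m"
proof -
  have "D (hurwitz_mult a b m) = hurwitz_mult (\<lambda>i. D (a i)) b m + hurwitz_mult a (\<lambda>i. D (b i)) m"
    by (simp add: hurwitz_mult_def D_sum D_mult algebra_simps sum.distrib)
  then show ?thesis
    by (simp add: x_inv_times_def[abs_def] hurwitz_mult_add hurwitz_mult_Suc)
qed

text \<open>
  Both sides solve \<open>\<delta> y = (k + 1) f \<cdot> (previous power)\<close> with \<open>y = 0\<close> at
  \<open>t = 0\<close>: the left one because \<open>\<delta>\<close> strips a factor \<open>u\<close> from a skew power and
  leaves \<open>f\<close>, the right one by the power rule for the derivation \<open>\<delta>\<close>. Commutative powers,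
  unlike skew ones, are compatible with \<open>\<tau>\<close> in an evident way.
\<close>

lemma fact_skew_power:
  assumes "u 0 = 0" and "\<delta> u = skew_const f"
  shows "of_nat (fact k) * skew_power D u k m = hurwitz_power u k m"
proof -
  have \<delta>_hurwitz: "\<delta> (hurwitz_power u (Suc k)) m = of_nat (Suc k) * (f * hurwitz_power u k m)" for k m
  proof (induction k arbitrary: m)
    case 0
    have "\<delta> (skew_const 1) = (\<lambda>_. 0)"
      by (auto simp: x_inv_times_def skew_const_def)
    then show ?case
      by (simp add: x_inv_times_hurwitz_mult assms(2) hurwitz_mult_const) (simp add: hurwitz_mult_def)
  next
    case (Suc k)
    then have "\<delta> (hurwitz_power u (Suc k)) = (\<lambda>m. (of_nat (Suc k) * f) * hurwitz_power u k m)"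
      by (simp add: fun_eq_iff mult.assoc)
    then have "\<delta> (hurwitz_power u (Suc (Suc k))) m =
        f * hurwitz_power u (Suc k) m + (of_nat (Suc k) * f) * hurwitz_mult u (hurwitz_power u k) m"
      by (subst hurwitz_power.simps(2))
        (simp only: x_inv_times_hurwitz_mult assms(2) hurwitz_mult_const hurwitz_mult_scale)
    then show ?case by (simp add: algebra_simps)
  qed
  have "(\<lambda>m. of_nat (fact k) * skew_power D u k m) = hurwitz_power u k"
  proof (induction k)
    case (Suc k)
    show ?case
    proof (rule x_inv_times_eqD)
      show "of_nat (fact (Suc k)) * skew_power D u (Suc k) 0 = hurwitz_power u (Suc k) 0"
        by (simp add: skew_mult_def assms(1))
      show "\<delta> (\<lambda>m. of_nat (fact (Suc k)) * skew_power D u (Suc k) m) = \<delta> (hurwitz_power u (Suc k))"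
      proof
        fix m
        have "\<delta> (\<lambda>m. of_nat (fact (Suc k)) * skew_power D u (Suc k) m) m =
            of_nat (fact (Suc k)) * \<delta> (skew_power D u (Suc k)) m"
          by (simp only: x_inv_times_def D_of_nat_mult) (simp add: algebra_simps)
        also have "\<dots> = of_nat (fact (Suc k)) * (f * skew_power D u k m)"
          by (simp add: x_inv_times_skew_mult assms skew_mult_const)
        also have "\<dots> = of_nat (Suc k) * (f * (of_nat (fact k) * skew_power D u k m))"
          by (simp add: algebra_simps)
        also have "\<dots> = \<delta> (hurwitz_power u (Suc k)) m"
          unfolding \<delta>_hurwitz using Suc by (simp add: fun_eq_iff)
        finally show "\<delta> (\<lambda>m. of_nat (fact (Suc k)) * skew_power D u (Suc k) m) m = \<dots>" .
      qed
    qed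
  qed simp
  then show ?thesis by (rule fun_cong)
qed

lemma reflection_0 [simp]: "\<tau> a 0 = a 0"
  by (simp add: reflection_def)

text \<open>
  As \<open>\<partial>\<^sub>t \<tau> = - \<tau> \<delta>\<close>, with the shift as \<open>\<partial>\<^sub>t\<close>,
  properties of \<open>\<tau>\<close> follow by induction on the coefficient from those of \<open>\<delta>\<close>.
\<close>

lemma reflection_Suc: "\<tau> a (Suc m) = - \<tau> (\<delta> a) m"
  by (simp add: reflection_def funpow_swap1)

lemma reflection_add: "\<tau> (\<lambda>i. a i + b i) m = \<tau> a m + \<tau> b m"
proof (induction m arbitrary: a b)
  case (Suc m)
  have "\<delta> (\<lambda>i. a i + b i) = (\<lambda>i. \<delta> a i + \<delta> b i)"
    by (simp add: x_inv_times_def fun_eq_iff D_add)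
  then show ?case using Suc[of "\<delta> a" "\<delta> b"] by (simp add: reflection_Suc)
qed simp

lemma reflection_of_nat_mult: "\<tau> (\<lambda>i. of_nat n * a i) m = of_nat n * \<tau> a m"
proof (induction m arbitrary: a)
  case (Suc m)
  have "\<delta> (\<lambda>i. of_nat n * a i) = (\<lambda>i. of_nat n * \<delta> a i)"
    by (simp add: x_inv_times_def fun_eq_iff D_of_nat_mult algebra_simps)
  then show ?case using Suc[of "\<delta> a"] by (simp add: reflection_Suc)
qed simp

lemma reflection_zero: "\<tau> (\<lambda>_. 0) m = 0"
  using reflection_of_nat_mult[of 0 "\<lambda>_. 0" m] by simp

lemma reflection_sum: "\<tau> (\<lambda>i. \<Sum>j\<in>A. h j i) m = (\<Sum>j\<in>A. \<tau> (h j) m)"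
proof (induction A rule: infinite_finite_induct)
  case (insert j A)
  then show ?case by (simp add: reflection_add)
qed (simp_all add: reflection_zero)

lemma reflection_skew_const:
  assumes "D f = 0"
  shows "\<tau> (skew_const f) = skew_const f"
proof
  have "\<delta> (skew_const f) = (\<lambda>_. 0)"
    using assms by (auto simp: x_inv_times_def skew_const_def)
  then show "\<tau> (skew_const f) m = skew_const f m" for m
    by (cases m) (simp_all add: reflection_Suc reflection_zero skew_const_def)
qed

text \<open>
  A substitution is multiplicative. Formally, both sides have the same derivative in \<open>t\<close>, as
  \<open>\<delta>\<close> and the shift are both derivations of the Hurwitz product.
\<close>

lemma reflection_hurwitz_mult: "\<tau> (hurwitz_mult a b) m = hurwitz_mult (\<tau> a) (\<tau> b) m"
proof (induction m arbitrary: a b)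
  case (Suc m)
  have neg: "(\<lambda>i. \<tau> c (Suc i)) = (\<lambda>i. - \<tau> (\<delta> c) i)" for c
    by (simp add: fun_eq_iff reflection_Suc)
  have "\<delta> (hurwitz_mult a b) = (\<lambda>m. hurwitz_mult (\<delta> a) b m + hurwitz_mult a (\<delta> b) m)"
    by (simp add: fun_eq_iff x_inv_times_hurwitz_mult)
  then have "\<tau> (hurwitz_mult a b) (Suc m) =
      - (hurwitz_mult (\<tau> (\<delta> a)) (\<tau> b) m + hurwitz_mult (\<tau> a) (\<tau> (\<delta> b)) m)"
    by (simp add: reflection_Suc reflection_add Suc)
  then show ?case
    by (simp add: hurwitz_mult_Suc neg hurwitz_mult_minus)
qed simp

lemma x_inv_times_funpow:
  "(\<delta> ^^ m) a l = (\<Sum>i\<le>m. of_nat (m choose i) * (D ^^ (m - i)) (a (l + i)))"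
proof (induction m arbitrary: l)
  case (Suc m)
  have "(\<Sum>i\<le>m. of_nat (m choose i) * (D ^^ Suc (m - i)) (a (l + i))) =
      (\<Sum>i\<le>Suc m. of_nat (m choose i) * (D ^^ (Suc m - i)) (a (l + i)))"
    by (simp add: Suc_diff_le binomial_eq_0)
  also have "\<dots> = (D ^^ Suc m) (a l) +
      (\<Sum>i\<le>m. of_nat (m choose Suc i) * (D ^^ (m - i)) (a (l + Suc i)))"
    by (subst sum.atMost_Suc_shift) simp
  finally have *: "(\<Sum>i\<le>m. of_nat (m choose i) * (D ^^ Suc (m - i)) (a (l + i))) = \<dots>" .
  have "(\<delta> ^^ Suc m) a l = (\<Sum>i\<le>m. of_nat (m choose i) * (D ^^ (m - i)) (a (l + Suc i))) +
      (\<Sum>i\<le>m. of_nat (m choose i) * (D ^^ Suc (m - i)) (a (l + i)))"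
    by (simp add: x_inv_times_def Suc D_sum D_of_nat_mult)
  also have "\<dots> = (\<Sum>i\<le>Suc m. of_nat (Suc m choose i) * (D ^^ (Suc m - i)) (a (l + i)))"
    unfolding * by (subst sum.atMost_Suc_shift) (simp add: algebra_simps sum.distrib)
  finally show ?case .
qed simp

text \<open>
  The generating function is \<open>W(z) - W(z - t)\<close> with \<open>W' = f\<close>, and \<open>(z, t) \<mapsto> (z - t, - t)\<close>
  exchanges \<open>z\<close> and \<open>z - t\<close>.
\<close>

lemma reflection_x_times_const: "\<tau> (x_times D (skew_const f)) m = - x_times D (skew_const f) m"
proof (cases m)
  case (Suc n)
  have "x_times D (skew_const f) (Suc n) = (- 1) ^ n * (D ^^ n) f"
    by (induction n) (simp_all add: x_times_Suc skew_const_def D_minus_one_power_mult)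
  moreover have "\<tau> (skew_const f) n = (- 1) ^ n * (D ^^ n) f"
  proof -
    have "(\<delta> ^^ n) (skew_const f) 0 = (\<Sum>i\<in>{0}. of_nat (n choose i) * (D ^^ (n - i)) (skew_const f i))"
      unfolding x_inv_times_funpow by (rule sum.mono_neutral_cong_right) (auto simp: skew_const_def)
    then show ?thesis by (simp add: reflection_def skew_const_def)
  qed
  ultimately show ?thesis
    by (simp add: Suc reflection_Suc x_inv_times_x_times)
qed simp

lemma reflection_skew_power:
  "\<tau> (skew_power D (x_times D (skew_const f)) k) m =
    (- 1) ^ k * skew_power D (x_times D (skew_const f)) k m"
proof -
  let ?u = "x_times D (skew_const f)"
  have "\<tau> (hurwitz_power ?u k) m = (- 1) ^ k * hurwitz_power ?u k m" for m
  proof (induction k arbitrary: m)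
    case 0
    show ?case
      by (simp add: reflection_skew_const)
  next
    case (Suc k)
    then have "\<tau> (hurwitz_power ?u k) = (\<lambda>m. (- 1) ^ k * hurwitz_power ?u k m)"
      and "\<tau> ?u = (\<lambda>m. - ?u m)"
      by (simp_all add: fun_eq_iff reflection_x_times_const)
    then show ?case
      by (simp add: reflection_hurwitz_mult hurwitz_mult_scale hurwitz_mult_minus)
  qed
  then have "\<tau> (\<lambda>m. of_nat (fact k) * skew_power D ?u k m) m =
      (- 1) ^ k * (of_nat (fact k) * skew_power D ?u k m)"
    by (simp only: fact_skew_power[OF x_times_0 x_inv_times_x_times])
  then have "of_nat (fact k) * \<tau> (skew_power D ?u k) m =
      of_nat (fact k) * ((- 1) ^ k * skew_power D ?u k m)"
    by (simp only: reflection_of_nat_mult mult_ac)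
  then show ?thesis
    by (rule of_nat_mult_cancel[rotated]) simp
qed

end

section \<open>The reflection of a lift\<close>

text \<open>
  The quotient of factorials is \<open>\<integral> s^(p+n) (1-s)^q ds\<close> over \<open>[0,1]\<close>. Summing under the
  integral gives \<open>\<integral> s^p (1-s)^(q+N) ds\<close>, which is the right-hand side. The proof is by the
  recursion \<open>B(p, q) - B(p+1, q) = B(p, q+1)\<close> for these integrals.
\<close>

lemma beta_sum:
  "(\<Sum>n\<le>N. (- 1) ^ n * of_nat (N choose n) * (fact (p + n) * fact q / fact (p + q + n + 1))) =
    (fact p * fact (q + N) / fact (p + q + N + 1) :: 'a::field_char_0)"
proof (induction N arbitrary: p)
  case (Suc N)
  define \<beta> :: "nat \<Rightarrow> nat \<Rightarrow> 'a" where "\<beta> p n = fact (p + n) * fact q / fact (p + q + n + 1)" for p n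
  have "(\<Sum>n\<le>N. (- 1) ^ n * of_nat (N choose n) * \<beta> p n) =
      (\<Sum>n\<le>Suc N. (- 1) ^ n * of_nat (N choose n) * \<beta> p n)"
    by simp
  also have "\<dots> = \<beta> p 0 - (\<Sum>n\<le>N. (- 1) ^ n * of_nat (N choose Suc n) * \<beta> (Suc p) n)"
    by (subst sum.atMost_Suc_shift) (simp add: sum_negf \<beta>_def)
  finally have *: "(\<Sum>n\<le>N. (- 1) ^ n * of_nat (N choose n) * \<beta> p n) = \<dots>" .
  have "(\<Sum>n\<le>Suc N. (- 1) ^ n * of_nat (Suc N choose n) * \<beta> p n) =
      \<beta> p 0 - (\<Sum>n\<le>N. (- 1) ^ n * of_nat (Suc N choose Suc n) * \<beta> (Suc p) n)"
    by (subst sum.atMost_Suc_shift) (simp add: sum_negf \<beta>_def)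
  also have "\<dots> = (\<Sum>n\<le>N. (- 1) ^ n * of_nat (N choose n) * \<beta> p n) -
      (\<Sum>n\<le>N. (- 1) ^ n * of_nat (N choose n) * \<beta> (Suc p) n)"
    unfolding * by (simp add: algebra_simps sum.distrib)
  also have "\<dots> = fact p * fact (q + N) / fact (p + q + N + 1) -
      fact (Suc p) * fact (q + N) / fact (Suc p + q + N + 1)"
    unfolding \<beta>_def using Suc[of p] Suc[of "Suc p"] by simp
  also have "\<dots> = fact p * fact (q + Suc N) / fact (p + q + Suc N + 1)"
  proof -
    have frac: "A * B / F - (a * A) * B / ((a + b) * F) = A * (b * B) / ((a + b) * F)"
      if "F \<noteq> 0" "a + b \<noteq> 0" for A B F a b :: 'a
      using that by (simp add: divide_simps) (simp add: algebra_simps)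
    have "fact (Suc p + q + N + 1) =
        (of_nat (Suc p) + of_nat (q + Suc N)) * (fact (p + q + N + 1) :: 'a)"
      and "fact (p + q + Suc N + 1) =
        (of_nat (Suc p) + of_nat (q + Suc N)) * (fact (p + q + N + 1) :: 'a)"
      and "fact (Suc p) = of_nat (Suc p) * (fact p :: 'a)"
      and "fact (q + Suc N) = of_nat (q + Suc N) * (fact (q + N) :: 'a)"
      by (simp_all add: algebra_simps)
    moreover have "of_nat (Suc p) + of_nat (q + Suc N) \<noteq> (0 :: 'a)"
      unfolding of_nat_add[symmetric] of_nat_eq_0_iff by simp
    ultimately show ?thesis
      by (simp only:) (rule frac[OF fact_nonzero])
  qed
  finally show ?case by (simp add: \<beta>_def)
qed simp

definition psi_coeff :: "nat \<Rightarrow> nat \<Rightarrow> complex"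
  where "psi_coeff j n = fact (2 * j - 1) * fact (n + j - 1) / (fact (n + 2 * j - 1) * fact (j - 1))
    * ((- of_nat j - 1) gchoose n)"

text \<open>
  Since \<open>(-j-1 gchoose n) = (-1)^n (j+n choose n)\<close>, the coefficients of a lift are those of a
  beta integral.
\<close>

lemma psi_coeff_eq:
  "psi_coeff (Suc p) n = (- 1) ^ n * of_nat ((Suc p + n) choose n) *
     (fact (2 * p + 1) / (fact p * fact p)) * (fact (p + n) * fact p / fact (p + p + n + 1))"
proof -
  have "(- of_nat (Suc p) - 1 :: complex) gchoose n = (- 1) ^ n * ((of_nat (Suc p + n)) gchoose n)"
    by (subst gbinomial_negated_upper) (simp add: algebra_simps)
  also have "\<dots> = (- 1) ^ n * of_nat ((Suc p + n) choose n)"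
    by (simp only: binomial_gbinomial)
  finally have gchoose: "(- of_nat (Suc p) - 1 :: complex) gchoose n = \<dots>" .
  have index: "2 * Suc p - 1 = 2 * p + 1" "n + Suc p - 1 = p + n"
      "n + 2 * Suc p - 1 = p + p + n + 1" "Suc p - 1 = p"
    by simp_all
  have frac: "a * b / (c * d) * (e * g) = e * g * (a / (d * d)) * (b * d / c)"
    if "d \<noteq> 0" for a b c d e g :: complex
    using that by (simp add: mult_ac)
  show ?thesis
    unfolding psi_coeff_def gchoose index by (rule frac[OF fact_nonzero])
qed

text \<open>
  The left-hand side is what \<open>\<tau>\<close> makes of the coefficients of a lift (see
  \<open>reflection_psi\<close>). The binomial coefficients regroup by trinomial revision, leaving the sum
  in \<open>beta_sum\<close> with \<open>p = q\<close>, where the right-hand side there is again of the form of its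
  summands.
\<close>

lemma psi_coeff_symmetric:
  "(\<Sum>n\<le>N. of_nat ((Suc p + N) choose (Suc p + n)) * psi_coeff (Suc p) n) =
    (- 1) ^ N * psi_coeff (Suc p) N"
proof -
  have choose: "((Suc p + N) choose (Suc p + n)) * ((Suc p + n) choose n) = ((Suc p + N) choose N) * (N choose n)"
    if "n \<le> N" for n
    using that choose_mult[of n "Suc p + n" "Suc p + N"] binomial_symmetric[of "Suc p" "Suc p + N"] 
      choose_mult[of "Suc p" "Suc p + n" "Suc p + N"] binomial_symmetric[of "Suc p" "Suc p + n"]
    by (simp add: mult.commute)
  define c :: complex where "c = fact (2 * p + 1) / (fact p * fact p)"
  have "(\<Sum>n\<le>N. of_nat ((Suc p + N) choose (Suc p + n)) * psi_coeff (Suc p) n) =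
      (\<Sum>n\<le>N. of_nat ((Suc p + N) choose N) * c *
        ((- 1) ^ n * of_nat (N choose n) * (fact (p + n) * fact p / fact (p + p + n + 1))))"
  proof (rule sum.cong[OF refl])
    fix n assume "n \<in> {..N}"
    then have "of_nat ((Suc p + N) choose (Suc p + n)) * of_nat ((Suc p + n) choose n) =
        (of_nat ((Suc p + N) choose N) * of_nat (N choose n) :: complex)"
      using choose[of n] by (simp only: flip: of_nat_mult) simp
    moreover have "A * (s * B * c * t) = A' * c * (s * B' * t)" if "A * B = A' * B'" for A A' B B' s t
    proof -
      have "A * (s * B * c * t) = (A * B) * c * (s * t)" "A' * c * (s * B' * t) = (A' * B') * c * (s * t)"
        by (simp_all only: mult_ac)
      with that show ?thesis by simp
    qed
    ultimately show "of_nat ((Suc p + N) choose (Suc p + n)) * psi_coeff (Suc p) n =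
        of_nat ((Suc p + N) choose N) * c *
        ((- 1) ^ n * of_nat (N choose n) * (fact (p + n) * fact p / fact (p + p + n + 1)))"
      unfolding psi_coeff_eq c_def[symmetric] by blast
  qed
  also have "\<dots> = of_nat ((Suc p + N) choose N) * c * (fact p * fact (p + N) / fact (p + p + N + 1))"
    unfolding sum_distrib_left[symmetric] beta_sum ..
  also have "\<dots> = (- 1) ^ N * psi_coeff (Suc p) N"
  proof -
    have "x * c * (y * z / w) = (- 1) ^ N * ((- 1) ^ N * x * c * (z * y / w))" for x y z w
      by (cases "even N") simp_all
    then show ?thesis unfolding psi_coeff_eq c_def[symmetric] .
  qed
  finally show ?thesis .
qed

context complex_differential_algebra
begin

lemma psi_low: "m < j \<Longrightarrow> psi smul D j f m = 0"
  by (auto simp: psi_def)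

lemma psi_shift: "j > 0 \<Longrightarrow> psi smul D j f (j + n) = smul (psi_coeff j n) ((D ^^ n) f)"
  by (simp add: psi_def psi_coeff_def Let_def)

lemma psi_leading: "psi smul D j f j = f"
  using psi_shift[of j f 0] by (cases "j = 0") (simp_all add: psi_def skew_const_def psi_coeff_def smul_one)

lemma psi_minus_one_power: "psi smul D j ((- 1) ^ s * f) m = (- 1) ^ s * psi smul D j f m"
proof -
  have "(D ^^ n) (- f) = - (D ^^ n) f" for n f
    by (induction n) simp_all
  then show ?thesis
    by (cases "even s") (simp_all add: psi_def skew_const_def Let_def smul_minus_right)
qed

text \<open>
  For \<open>j > 0\<close> this is the symmetry of the beta weight. The lift of weight zero, the constant
  series \<open>f\<close>, goes to \<open>x f x\<^sup>-\<^sup>1\<close>, which is \<open>f\<close> only if \<open>D f = 0\<close>.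
\<close>

lemma reflection_psi:
  assumes "j > 0 \<or> D f = 0"
  shows "\<tau> (psi smul D j f) m = (- 1) ^ j * psi smul D j f m"
proof (cases "j > 0")
  case False
  then show ?thesis
    using assms by (simp add: psi_def reflection_skew_const)
next
  case True
  have expand: "(\<delta> ^^ m) (psi smul D j f) 0 =
      (\<Sum>i\<le>m. of_nat (m choose i) * (D ^^ (m - i)) (psi smul D j f i))"
    by (simp add: x_inv_times_funpow)
  show ?thesis
  proof (cases "j \<le> m")
    case False
    then show ?thesis by (simp add: reflection_def expand psi_low)
  next
    case le: True
    then obtain N where m: "m = j + N" using le_Suc_ex by blast
    have "(\<delta> ^^ m) (psi smul D j f) 0 =
        (\<Sum>i\<in>{j..j + N}. of_nat (m choose i) * (D ^^ (m - i)) (psi smul D j f i))"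
      unfolding expand by (rule sum.mono_neutral_right) (auto simp: m psi_low)
    also have "\<dots> = (\<Sum>n\<le>N. of_nat (m choose (j + n)) * (D ^^ (N - n)) (psi smul D j f (j + n)))"
      by (rule sum.reindex_bij_witness[of _ "\<lambda>n. j + n" "\<lambda>i. i - j"]) (auto simp: m add.commute)
    also have "\<dots> = (\<Sum>n\<le>N. smul (of_nat (m choose (j + n)) * psi_coeff j n) ((D ^^ N) f))"
    proof (rule sum.cong[OF refl])
      fix n assume "n \<in> {..N}"
      then have "(D ^^ (N - n)) ((D ^^ n) f) = (D ^^ N) f"
        by (metis atMost_iff comp_apply funpow_add le_add_diff_inverse2)
      then show "of_nat (m choose (j + n)) * (D ^^ (N - n)) (psi smul D j f (j + n)) =
          smul (of_nat (m choose (j + n)) * psi_coeff j n) ((D ^^ N) f)"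
        using True by (simp add: psi_shift D_funpow_smul smul_of_nat_mult)
    qed
    also have "\<dots> = smul ((- 1) ^ N * psi_coeff j N) ((D ^^ N) f)"
      using psi_coeff_symmetric[where p = "j - 1" and N = N] True m by (simp flip: smul_sum_left)
    also have "\<dots> = (- 1) ^ N * psi smul D j f m"
      using True by (simp add: smul_minus_one_power m psi_shift)
    finally show ?thesis
      by (simp add: reflection_def m power_add)
  qed
qed

text \<open>
  A lift starts with \<open>f x^j\<close>, so \<open>Psi2\<close> is unitriangular.
\<close>

lemma Psi2_inject:
  assumes "Psi2 smul D F = Psi2 smul D G"
  shows "F = G"
proof
  fix m show "F m = G m"
  proof (induction m rule: less_induct)
    case (less m)
    have "Psi2 smul D H m = (\<Sum>j<m. psi smul D j (H j) m) + H m" for H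
      by (simp add: Psi2_def psi_leading flip: lessThan_Suc_atMost)
    then show ?case using fun_cong[OF assms, of m] less by simp
  qed
qed

lemma reflection_Psi2:
  assumes "D (F 0) = 0"
  shows "\<tau> (Psi2 smul D F) = Psi2 smul D (\<lambda>j. (- 1) ^ j * F j)"
proof
  fix m
  \<comment> \<open>The sum defining \<open>Psi2\<close> depends on the coefficient; it can be given a fixed range since \<open>\<tau>\<close> looks only at coefficients up to \<open>m\<close>.\<close>
  have cong: "\<tau> a m = \<tau> b m" if "\<And>i. i \<le> m \<Longrightarrow> a i = b i" for a b
    by (simp add: reflection_def x_inv_times_funpow that)
  have "\<tau> (Psi2 smul D F) m = \<tau> (\<lambda>i. \<Sum>j\<le>m. psi smul D j (F j) i) m"
    by (rule cong) (auto simp: Psi2_def intro!: sum.mono_neutral_left psi_low)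
  also have "\<dots> = (\<Sum>j\<le>m. (- 1) ^ j * psi smul D j (F j) m)"
    unfolding reflection_sum by (intro sum.cong refl reflection_psi) (metis assms gr0I)
  also have "\<dots> = Psi2 smul D (\<lambda>j. (- 1) ^ j * F j) m"
    by (simp add: Psi2_def psi_minus_one_power)
  finally show "\<tau> (Psi2 smul D F) m = \<dots>" .
qed

text \<open>
  Equality of the reflections of both sides of the hypothesis, read through the injectivity of
  \<open>Psi2\<close>. The component of weight zero is \<open>1\<close> for \<open>k = 0\<close> and \<open>0\<close> otherwise, hence
  a constant, as \<open>reflection_Psi2\<close> requires.
\<close>

theorem components_of_skew_power_parity:
  assumes F: "Psi2 smul D F = skew_power D (x_times D (skew_const f)) k"
    and "odd i"
  shows "F (k + i) = 0"
proof -
  let ?u = "x_times D (skew_const f)"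
  have "F 0 = skew_power D ?u k 0"
    using fun_cong[OF F, of 0] by (simp add: Psi2_def psi_leading)
  then have "D (F 0) = 0"
    by (cases k) (simp_all add: skew_const_def skew_mult_def)
  then have "Psi2 smul D (\<lambda>j. (- 1) ^ j * F j) = \<tau> (Psi2 smul D F)"
    by (simp add: reflection_Psi2)
  also have "\<dots> = (\<lambda>m. (- 1) ^ k * Psi2 smul D F m)"
    by (simp add: F fun_eq_iff reflection_skew_power)
  also have "\<dots> = Psi2 smul D (\<lambda>j. (- 1) ^ k * F j)"
    by (simp add: fun_eq_iff Psi2_def psi_minus_one_power sum_distrib_left)
  finally have "(- 1) ^ (k + i) * F (k + i) = (- 1) ^ k * F (k + i)"
    by (rule fun_cong[OF Psi2_inject])
  then have "of_nat 2 * F (k + i) = of_nat 2 * 0"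
    using \<open>odd i\<close> by (cases "even k") auto
  then show ?thesis by (rule of_nat_mult_cancel[rotated]) simp
qed

end

theorem corollary2p4p6:
  fixes U :: "complex set"
    and \<Gamma> :: "(complex^2^2) set"
    and ev :: "'r::idom \<Rightarrow> complex \<Rightarrow> complex"
    and smul :: "complex \<Rightarrow> 'r \<Rightarrow> 'r"
    and D :: "'r \<Rightarrow> 'r"
    and chi :: 'r
    and u :: "nat \<Rightarrow> 'r"
    and g :: "nat \<Rightarrow> nat \<Rightarrow> 'r"
    and k i :: nat
  assumes "homographic_function_algebra U \<Gamma> ev smul D"
    and "chi \<in> modular_forms U \<Gamma> ev 2"
    and "chi dvd 1"
    and "u = skew_mult D skew_x (skew_const chi)"
    and "\<And>k n. k \<le> n \<Longrightarrow> g k (2 * n) \<in> modular_forms U \<Gamma> ev (2 * int n)"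
    and "\<And>k. Psi2 smul D (\<lambda>n. if k \<le> n then g k (2 * n) else 0) = skew_power D u k"
    and "odd i"
  shows "g k (2 * k + 2 * i) = 0"
proof -
  interpret complex_differential_algebra smul D
    using assms(1) by (rule homographic_function_algebra.complex_differential_algebra)
  have "u = x_times D (skew_const chi)"
    using assms(4) by (simp add: skew_mult_skew_x)
  then have "(if k \<le> k + i then g k (2 * (k + i)) else 0) = 0"
    using components_of_skew_power_parity[of "\<lambda>n. if k \<le> n then g k (2 * n) else 0" chi k i]
      assms(6)[of k] assms(7) by simp
  then show ?thesis by (simp add: distrib_left)
qed

end
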